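(* Let $q$ be an odd prime and $n$ a positive integer. Let $T(n,q)$ be the maximal size of a subset of $\{a,b\}^n$ (with $a\neq b$) in which no two distinct vectors have Hamming distance divisible by $q$. Then: \begin{align*} T(n,q)&\le \binom{n}{q-1}+\binom{n}{q-2}+\dots+\binom{n}{1}+\binom{n}{0}\qquad \text{in general,}\\ T(n,q)&\le \binom{n}{q-1}+\binom{n}{q-3}+\dots+\binom{n}{2}+\binom{n}{0} \qquad\text{if } n\equiv 0 \pmod q,\\ T(n,q)&\ge\binom{n}{q-1}+\binom{n}{q-3}+\dots+\binom{n}{2}+\binom{n}{0}\qquad \text{in general,}\\ T(n,q)&\ge\binom{n}{q-1}+\binom{n}{q-2}+\dots+\binom{n}{1}+\binom{n}{0}\qquad\text{if } n\equiv -1 \pmod q. \end{align*}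
   Context: The Hamming distance of two words of length $n$ is the number of coordinates in which they differ. *)

theory Defs
  imports Complex_Main "HOL-Number_Theory.Number_Theory"
begin

text \<open>Words of length \<open>n\<close> are lists of length \<open>n\<close>; the distance is only meaningful for lists
  of equal length.\<close>

definition hamming_dist :: "'a list \<Rightarrow> 'a list \<Rightarrow> nat" where
  "hamming_dist x y = card {i. i < length x \<and> x ! i \<noteq> y ! i}"

definition words :: "'a set \<Rightarrow> nat \<Rightarrow> 'a list set" where
  "words A n = {x. set x \<subseteq> A \<and> length x = n}"

definition no_dist_divisible :: "nat \<Rightarrow> 'a list set \<Rightarrow> bool" where
  "no_dist_divisible q S \<longleftrightarrow> (\<forall>x\<in>S. \<forall>y\<in>S. x \<noteq> y \<longrightarrow> \<not> q dvd hamming_dist x y)"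

text \<open>The maximum ranges over a finite set (there are finitely many words), which is nonempty
  since the empty set of words is admissible.\<close>

definition T :: "'a \<Rightarrow> 'a \<Rightarrow> nat \<Rightarrow> nat \<Rightarrow> nat" where
  "T a b n q = Max {card S | S. S \<subseteq> words {a, b} n \<and> no_dist_divisible q S}"

end

theory Submission
  imports Defs
begin

text \<open>Identify words with subsets of \<open>{..<n}\<close>, the Hamming distance becoming the size \<open>d\<close> of the
  symmetric difference, and subsets with sign vectors, so that \<open>n - 2 d\<close> is the inner product
  \<open>s\<close> of two sign vectors.  By Fermat the matrix with entries \<open>1 - (n - s)^(q - 1)\<close>, indexed by an
  admissible family, is congruent to the identity modulo \<open>q\<close>.  Since \<open>(\<plusminus>1)\<^sup>2 = 1\<close>, its entries are
  multilinear of degree at most \<open>q - 1\<close> in the products of coordinates, so its rank modulo \<open>q\<close> is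
  at most the number of multilinear monomials.  If \<open>q\<close> divides \<open>n\<close>, then \<open>s\<close> may replace \<open>n - s\<close>,
  and only monomials of even degree survive.

  For the lower bounds, sets of even size at most \<open>q - 1\<close> have even distances below \<open>2 q\<close>.  If
  \<open>n \<equiv> -1\<close>, the complements of the sets of odd size below \<open>q\<close> can be added: a mixed distance is
  \<open>n - d\<close> with \<open>d\<close> odd and \<open>d + 1 < 2 q\<close>, and \<open>q\<close> would have to divide \<open>d + 1\<close>.\<close>

section \<open>Linear algebra modulo a prime\<close>

text \<open>Over the field of residues modulo \<open>q\<close>, a homogeneous system with fewer
  equations than unknowns has a nontrivial solution. Divisibility keeps everything in the integers,
  and the induction is Gaussian elimination, one equation at a time.\<close>

lemma homogeneous_system_mod_prime:
  fixes q :: int and M :: "'a \<Rightarrow> 'b \<Rightarrow> int"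
  assumes "prime q" "finite I" "finite X" "card I < card X"
  shows "\<exists>c. (\<exists>x\<in>X. \<not> q dvd c x) \<and> (\<forall>i\<in>I. q dvd (\<Sum>x\<in>X. c x * M x i))"
  using assms(2-4)
proof (induction I arbitrary: X M rule: finite_induct)
  case empty
  then have "X \<noteq> {}" by auto
  then have "(\<exists>x\<in>X. \<not> q dvd (\<lambda>_. 1) x)"
    using assms(1) by (auto simp: not_prime_unit)
  then show ?case by (intro exI[of _ "\<lambda>_. 1"]) auto
next
  case (insert i I)
  show ?case
  proof (cases "\<forall>x\<in>X. q dvd M x i")
    case True
    obtain c where "\<exists>x\<in>X. \<not> q dvd c x" "\<forall>i\<in>I. q dvd (\<Sum>x\<in>X. c x * M x i)"
      using insert.IH[of X M] insert.prems insert.hyps by auto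
    moreover have "q dvd (\<Sum>x\<in>X. c x * M x i)"
      using True by (intro dvd_sum) auto
    ultimately show ?thesis by blast
  next
    case False
    then obtain z where z: "z \<in> X" "\<not> q dvd M z i" by blast
    let ?Y = "X - {z}"
    \<comment> \<open>Elimination of the unknown \<open>z\<close> with pivot \<open>M z i\<close>;
      cross-multiplication avoids inverting the pivot. The new coefficients for equation
      \<open>i\<close> vanish identically.\<close>
    define M' where "M' x j = M z i * M x j - M x i * M z j" for x j
    have "card I < card ?Y"
      using insert z by simp
    then obtain c where c: "\<exists>x\<in>?Y. \<not> q dvd c x"
        "\<forall>j\<in>I. q dvd (\<Sum>x\<in>?Y. c x * M' x j)"
      using insert.IH[of ?Y M'] insert.prems by auto
    \<comment> \<open>Back-substitution: scaling by the pivot, a unit modulo \<open>q\<close>,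
      preserves nontriviality, and the value at \<open>z\<close> makes equation \<open>i\<close>
      hold exactly.\<close>
    define c' where "c' x = (if x = z then - (\<Sum>y\<in>?Y. c y * M y i) else M z i * c x)" for x
    have eq: "(\<Sum>x\<in>X. c' x * M x j) = (\<Sum>x\<in>?Y. c x * M' x j)" for j
    proof -
      have "(\<Sum>x\<in>X. c' x * M x j) = c' z * M z j + (\<Sum>x\<in>?Y. c' x * M x j)"
        using insert.prems z by (simp add: sum.remove)
      also have "(\<Sum>x\<in>?Y. c' x * M x j) = (\<Sum>x\<in>?Y. M z i * c x * M x j)"
        by (intro sum.cong) (auto simp: c'_def)
      also have "c' z * M z j + \<dots> = (\<Sum>x\<in>?Y. c x * M' x j)"
        by (simp add: c'_def M'_def sum_distrib_right sum_distrib_left sum_subtractf algebra_simps)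
      finally show ?thesis .
    qed
    obtain x where x: "x \<in> ?Y" "\<not> q dvd c x" using c by blast
    then have "\<not> q dvd c' x"
      using z assms(1) by (auto simp: c'_def prime_dvd_mult_iff)
    moreover have "q dvd (\<Sum>x\<in>X. c' x * M x j)" if "j \<in> insert i I" for j
    proof (cases "j = i")
      case True
      then show ?thesis unfolding eq by (simp add: M'_def mult.commute)
    next
      case False
      then show ?thesis using that c unfolding eq by blast
    qed
    ultimately show ?thesis using x by blast
  qed
qed

text \<open>A rank bound: the matrix \<open>f\<close> is diagonal and invertible modulo
  \<open>q\<close>, yet it factors through \<open>I\<close>. If \<open>X\<close> were larger than
  \<open>I\<close>, the rows of \<open>B\<close> would satisfy a nontrivial relation modulo
  \<open>q\<close>; carried over to \<open>f\<close>, it is contradicted in any column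
  \<open>y\<close> with \<open>c y\<close> nonzero modulo \<open>q\<close>.\<close>

lemma card_le_of_factorization_mod_prime:
  fixes q :: int and f :: "'a \<Rightarrow> 'a \<Rightarrow> int"
  assumes "prime q" "finite I" "finite X"
    and fact: "\<And>x y. x \<in> X \<Longrightarrow> y \<in> X \<Longrightarrow> f x y = (\<Sum>i\<in>I. B x i * C y i)"
    and diag: "\<And>x. x \<in> X \<Longrightarrow> \<not> q dvd f x x"
    and off: "\<And>x y. x \<in> X \<Longrightarrow> y \<in> X \<Longrightarrow> x \<noteq> y \<Longrightarrow> q dvd f x y"
  shows "card X \<le> card I"
proof (rule ccontr)
  assume "\<not> card X \<le> card I"
  then obtain c y where y: "y \<in> X" "\<not> q dvd c y"
    and c: "\<forall>i\<in>I. q dvd (\<Sum>x\<in>X. c x * B x i)"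
    using homogeneous_system_mod_prime[OF assms(1-3), of B] by force
  have "(\<Sum>x\<in>X. c x * f x y) = (\<Sum>x\<in>X. \<Sum>i\<in>I. c x * B x i * C y i)"
    using fact y by (simp add: sum_distrib_left mult.assoc)
  also have "\<dots> = (\<Sum>i\<in>I. (\<Sum>x\<in>X. c x * B x i) * C y i)"
    by (subst sum.swap) (simp add: sum_distrib_right)
  finally have "q dvd (\<Sum>x\<in>X. c x * f x y)"
    using c by (auto intro!: dvd_sum)
  moreover have "(\<Sum>x\<in>X. c x * f x y) = c y * f y y + (\<Sum>x\<in>X-{y}. c x * f x y)"
    using y assms(3) by (simp add: sum.remove)
  moreover have "q dvd (\<Sum>x\<in>X-{y}. c x * f x y)"
    using off y by (intro dvd_sum) auto
  ultimately have "q dvd c y * f y y"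
    by (metis dvd_add_left_iff)
  then show False
    using y diag assms(1) by (auto simp: prime_dvd_mult_iff)
qed

section \<open>Multilinear functions on sign vectors\<close>

text \<open>A monomial is encoded by its set of indices, and \<open>F\<close> collects the monomials
  allowed. Agreement is demanded only at sign vectors, so squares of coordinates may be replaced by
  1.\<close>

definition multilinear_on :: "nat \<Rightarrow> nat set set \<Rightarrow> ((nat \<Rightarrow> int) \<Rightarrow> int) \<Rightarrow> bool" where
  "multilinear_on n F f \<longleftrightarrow>
    (\<exists>e. \<forall>w. (\<forall>i<n. w i \<in> {1, -1}) \<longrightarrow> f w = (\<Sum>K\<in>F. e K * prod w K))"

lemma multilinear_on_monomial:
  assumes "finite F" "K \<in> F"
  shows "multilinear_on n F (\<lambda>w. prod w K)"
  unfolding multilinear_on_def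
proof (intro exI allI impI)
  fix w :: "nat \<Rightarrow> int"
  have "(\<Sum>L\<in>F. of_bool (L = K) * prod w L) = (\<Sum>L\<in>F. if L = K then prod w L else 0)"
    by (intro sum.cong) auto
  then show "prod w K = (\<Sum>L\<in>F. of_bool (L = K) * prod w L)"
    using assms by simp
qed

lemma multilinear_on_add:
  assumes "multilinear_on n F f" "multilinear_on n F g"
  shows "multilinear_on n F (\<lambda>w. f w + g w)"
proof -
  obtain e e' where "\<forall>w. (\<forall>i<n. w i \<in> {1, -1}) \<longrightarrow> f w = (\<Sum>K\<in>F. e K * prod w K)"
      "\<forall>w. (\<forall>i<n. w i \<in> {1, -1}) \<longrightarrow> g w = (\<Sum>K\<in>F. e' K * prod w K)"
    using assms unfolding multilinear_on_def by blast
  then show ?thesis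
    unfolding multilinear_on_def
    by (intro exI[of _ "\<lambda>K. e K + e' K"]) (simp add: distrib_right sum.distrib)
qed

lemma multilinear_on_scale:
  assumes "multilinear_on n F f"
  shows "multilinear_on n F (\<lambda>w. c * f w)"
proof -
  obtain e where "\<forall>w. (\<forall>i<n. w i \<in> {1, -1}) \<longrightarrow> f w = (\<Sum>K\<in>F. e K * prod w K)"
    using assms unfolding multilinear_on_def by blast
  then show ?thesis
    unfolding multilinear_on_def
    by (intro exI[of _ "\<lambda>K. c * e K"]) (simp add: sum_distrib_left mult.assoc)
qed

lemma multilinear_on_sum:
  assumes "\<And>i. i \<in> A \<Longrightarrow> multilinear_on n F (f i)"
  shows "multilinear_on n F (\<lambda>w. \<Sum>i\<in>A. f i w)"
proof -
  have zero: "multilinear_on n F (\<lambda>w. 0)"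
    unfolding multilinear_on_def by (intro exI[of _ "\<lambda>_. 0"]) simp
  show ?thesis
    using assms
  proof (induction A rule: infinite_finite_induct)
    case (insert x A)
    then show ?case by (simp add: multilinear_on_add)
  qed (use zero in auto)
qed

lemma multilinear_on_cong:
  assumes "multilinear_on n F f"
    and "\<And>w. (\<forall>i<n. w i \<in> {1, -1}) \<Longrightarrow> g w = f w"
  shows "multilinear_on n F g"
proof -
  obtain e where "\<forall>w. (\<forall>i<n. w i \<in> {1, -1}) \<longrightarrow> f w = (\<Sum>K\<in>F. e K * prod w K)"
    using assms unfolding multilinear_on_def by blast
  then show ?thesis
    unfolding multilinear_on_def by (intro exI[of _ e]) (simp add: assms(2))
qed

text \<open>Multiplying a monomial by a coordinate toggles its index: a repeated factor cancels
  because its square is 1.\<close>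

lemma prod_sym_diff_singleton:
  fixes w :: "'a \<Rightarrow> int"
  assumes "finite K" "w j \<in> {1, -1}"
  shows "prod w (sym_diff K {j}) = w j * prod w K"
proof (cases "j \<in> K")
  case True
  then have "sym_diff K {j} = K - {j}" by blast
  moreover have "w j * prod w K = (w j * w j) * prod w (K - {j})"
    using True assms(1) by (simp only: prod.remove mult.assoc)
  moreover have "w j * w j = 1" using assms(2) by auto
  ultimately show ?thesis by simp
next
  case False
  then have "sym_diff K {j} = insert j K" by blast
  then show ?thesis using False assms by simp
qed

lemma multilinear_on_times_sum:
  assumes "multilinear_on n F f" "finite F'" "F \<subseteq> Pow {..<n}"
    and shift: "\<And>K j. K \<in> F \<Longrightarrow> j < n \<Longrightarrow> sym_diff K {j} \<in> F'"
  shows "multilinear_on n F' (\<lambda>w. (\<Sum>i<n. w i) * f w)"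
proof -
  obtain e where e: "\<forall>w. (\<forall>i<n. w i \<in> {1, -1}) \<longrightarrow> f w = (\<Sum>K\<in>F. e K * prod w K)"
    using assms unfolding multilinear_on_def by blast
  have "multilinear_on n F' (\<lambda>w. \<Sum>K\<in>F. \<Sum>j<n. e K * prod w (sym_diff K {j}))"
    using assms by (intro multilinear_on_sum multilinear_on_scale multilinear_on_monomial) auto
  then show ?thesis
  proof (rule multilinear_on_cong)
    fix w :: "nat \<Rightarrow> int"
    assume w: "\<forall>i<n. w i \<in> {1, -1}"
    have "(\<Sum>i<n. w i) * f w = (\<Sum>j<n. \<Sum>K\<in>F. e K * (w j * prod w K))"
      using e w by (simp add: sum_product algebra_simps)
    also have "\<dots> = (\<Sum>K\<in>F. \<Sum>j<n. e K * (w j * prod w K))"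
      by (rule sum.swap)
    also have "\<dots> = (\<Sum>K\<in>F. \<Sum>j<n. e K * prod w (sym_diff K {j}))"
    proof (intro sum.cong refl)
      fix K j
      assume "K \<in> F" "j \<in> {..<n}"
      then have "prod w (sym_diff K {j}) = w j * prod w K"
        using w assms(3) by (intro prod_sym_diff_singleton) (auto intro: finite_subset)
      then show "e K * (w j * prod w K) = e K * prod w (sym_diff K {j})" by simp
    qed
    finally show "(\<Sum>i<n. w i) * f w = (\<Sum>K\<in>F. \<Sum>j<n. e K * prod w (sym_diff K {j}))" .
  qed
qed

section \<open>Powers of the coordinate sum, with monomials sorted by degree\<close>

abbreviation subsets_of_size_in :: "nat \<Rightarrow> nat set \<Rightarrow> nat set set" where
  "subsets_of_size_in n A \<equiv> {K. K \<subseteq> {..<n} \<and> card K \<in> A}"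

lemma card_subsets_of_size_in:
  assumes "finite A"
  shows "card (subsets_of_size_in n A) = (\<Sum>k\<in>A. n choose k)"
proof -
  have "subsets_of_size_in n A = (\<Union>k\<in>A. {K. K \<subseteq> {..<n} \<and> card K = k})"
    by auto
  also have "card \<dots> = (\<Sum>k\<in>A. card {K. K \<subseteq> {..<n} \<and> card K = k})"
    using assms by (intro card_UN_disjoint) auto
  also have "\<dots> = (\<Sum>k\<in>A. n choose k)"
    using n_subsets[of "{..<n}"] by simp
  finally show ?thesis .
qed

lemma card_sym_diff_singleton:
  assumes "finite K"
  shows "card (sym_diff K {j}) = (if j \<in> K then card K - 1 else card K + 1)"
proof (cases "j \<in> K")
  case True
  then have "sym_diff K {j} = K - {j}" by blast
  with True assms show ?thesis by simp
next
  case False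
  then have "sym_diff K {j} = insert j K" by blast
  with False assms show ?thesis by simp
qed

lemma multilinear_on_mono:
  assumes "multilinear_on n F f" "F \<subseteq> F'" "finite F'"
  shows "multilinear_on n F' f"
proof -
  obtain e where "\<forall>w. (\<forall>i<n. w i \<in> {1, -1}) \<longrightarrow> f w = (\<Sum>K\<in>F. e K * prod w K)"
    using assms unfolding multilinear_on_def by blast
  moreover have "multilinear_on n F' (\<lambda>w. \<Sum>K\<in>F. e K * prod w K)"
    using assms by (intro multilinear_on_sum multilinear_on_scale multilinear_on_monomial) auto
  ultimately show ?thesis
    by (auto intro: multilinear_on_cong)
qed

lemma multilinear_on_one:
  assumes "0 \<in> A"
  shows "multilinear_on n (subsets_of_size_in n A) (\<lambda>w. 1)"
  using multilinear_on_monomial[of "subsets_of_size_in n A" "{}" n] assms by simp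

text \<open>Each further factor either keeps an index set (the constant \<open>c\<close>) or toggles
  one index (the sum), so sizes grow by at most one per factor.\<close>

lemma multilinear_on_affine_power:
  "multilinear_on n (subsets_of_size_in n {..k}) (\<lambda>w. (c - (\<Sum>i<n. w i)) ^ k)"
proof (induction k)
  case 0
  then show ?case using multilinear_on_one[of "{..0}"] by simp
next
  case (Suc k)
  let ?S = "subsets_of_size_in n {..Suc k}" and ?f = "\<lambda>w. (c - (\<Sum>i<n. w i)) ^ k"
  have "multilinear_on n ?S (\<lambda>w. (\<Sum>i<n. w i) * ?f w)"
  proof (rule multilinear_on_times_sum[OF Suc])
    fix K j
    assume K: "K \<in> subsets_of_size_in n {..k}" and j: "j < n"
    then have "finite K" by (auto intro: finite_subset)
    then show "sym_diff K {j} \<in> ?S"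
      using K j card_sym_diff_singleton[of K j] by auto
  qed auto
  then have "multilinear_on n ?S (\<lambda>w. (-1) * ((\<Sum>i<n. w i) * ?f w))"
    by (rule multilinear_on_scale)
  moreover have "multilinear_on n ?S (\<lambda>w. c * ?f w)"
    by (intro multilinear_on_scale multilinear_on_mono[OF Suc]) auto
  ultimately have "multilinear_on n ?S (\<lambda>w. c * ?f w + (-1) * ((\<Sum>i<n. w i) * ?f w))"
    by (intro multilinear_on_add)
  then show ?case
    by (simp add: left_diff_distrib)
qed

text \<open>Without a constant term every factor toggles exactly one index, so the parity of the
  degree changes each time. This is what removes half of the monomials.\<close>

lemma multilinear_on_sum_power:
  "multilinear_on n (subsets_of_size_in n {l. l \<le> k \<and> even (l + k)}) (\<lambda>w. (\<Sum>i<n. w i) ^ k)"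
proof (induction k)
  case 0
  then show ?case using multilinear_on_one[of "{l. l \<le> 0 \<and> even (l + 0)}"] by simp
next
  case (Suc k)
  let ?S = "subsets_of_size_in n {l. l \<le> Suc k \<and> even (l + Suc k)}"
  have "multilinear_on n ?S (\<lambda>w. (\<Sum>i<n. w i) * (\<Sum>i<n. w i) ^ k)"
  proof (rule multilinear_on_times_sum[OF Suc])
    fix K j
    assume K: "K \<in> subsets_of_size_in n {l. l \<le> k \<and> even (l + k)}" and j: "j < n"
    then have fin: "finite K" by (auto intro: finite_subset)
    \<comment> \<open>Guards against truncated subtraction, which would spoil the parity of
      \<open>card K - 1\<close> at 0.\<close>
    have "card K > 0" if "j \<in> K" using that fin card_gt_0_iff by blast
    then show "sym_diff K {j} \<in> ?S"
      using K j card_sym_diff_singleton[OF fin, of j] by auto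
  qed auto
  then show ?case by simp
qed

section \<open>Set families avoiding distances divisible by \<open>q\<close>\<close>

definition avoiding :: "nat \<Rightarrow> nat set set \<Rightarrow> bool" where
  "avoiding q F \<longleftrightarrow> (\<forall>K\<in>F. \<forall>L\<in>F. K \<noteq> L \<longrightarrow> \<not> q dvd card (sym_diff K L))"

text \<open>The coordinatewise product of two sign vectors is again a sign vector, whose coordinate
  sum is their inner product. Each monomial of it splits into a factor for \<open>K\<close> and a
  factor for \<open>L\<close>, so the matrix of values of \<open>p\<close> factors through
  \<open>G\<close> and the rank bound applies.\<close>

lemma card_le_of_multilinear:
  fixes q :: nat
  assumes q: "prime q" and F: "F \<subseteq> Pow {..<n}" and G: "finite G" "G \<subseteq> Pow {..<n}"
    and p: "multilinear_on n G (\<lambda>w. p (\<Sum>i<n. w i))"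
    and diag: "\<not> int q dvd p (int n)"
    and off: "\<And>K L. K \<in> F \<Longrightarrow> L \<in> F \<Longrightarrow> K \<noteq> L \<Longrightarrow>
      int q dvd p (int n - 2 * int (card (sym_diff K L)))"
  shows "card F \<le> card G"
proof -
  define u :: "nat set \<Rightarrow> nat \<Rightarrow> int" where "u K i = (if i \<in> K then -1 else 1)" for K i
  obtain e where e: "\<forall>w. (\<forall>i<n. w i \<in> {1, -1}) \<longrightarrow>
      p (\<Sum>i<n. w i) = (\<Sum>K\<in>G. e K * prod w K)"
    using p unfolding multilinear_on_def by blast
  have inner: "(\<Sum>i<n. u K i * u L i) = int n - 2 * int (card (sym_diff K L))"
    if "K \<in> F" "L \<in> F" for K L
  proof -
    have "(\<Sum>i<n. u K i * u L i) = (\<Sum>i<n. 1 - 2 * of_bool (i \<in> sym_diff K L))"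
      by (intro sum.cong) (auto simp: u_def)
    also have "\<dots> = int n - 2 * (\<Sum>i<n. of_bool (i \<in> sym_diff K L))"
      by (simp add: sum_subtractf flip: sum_distrib_left)
    also have "(\<Sum>i<n. of_bool (i \<in> sym_diff K L)) = int (card ({..<n} \<inter> sym_diff K L))"
      by (simp only: sum_of_bool_eq finite_lessThan) (simp add: Int_def)
    also have "{..<n} \<inter> sym_diff K L = sym_diff K L"
      using that F by blast
    finally show ?thesis .
  qed
  show ?thesis
  proof (rule card_le_of_factorization_mod_prime[where q = "int q"
        and f = "\<lambda>K L. p (int n - 2 * int (card (sym_diff K L)))"
        and B = "\<lambda>K J. e J * prod (u K) J" and C = "\<lambda>L J. prod (u L) J"])
    show "finite F" using F by (rule finite_subset) simp
    fix K L
    assume KL: "K \<in> F" "L \<in> F"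
    have "p (\<Sum>i<n. u K i * u L i) = (\<Sum>J\<in>G. e J * (\<Prod>i\<in>J. u K i * u L i))"
      by (rule e[rule_format]) (auto simp: u_def)
    then show "p (int n - 2 * int (card (sym_diff K L)))
        = (\<Sum>J\<in>G. e J * prod (u K) J * prod (u L) J)"
      using inner[OF KL] by (simp add: prod.distrib mult.assoc)
  qed (use q G diag off in auto)
qed

lemma fermat_dvd_one_minus_power:
  assumes "prime q" "\<not> int q dvd a"
  shows "int q dvd 1 - a ^ (q - 1)"
proof -
  \<comment> \<open>The residue of the possibly negative \<open>a\<close>, as a natural number to
    which \<open>fermat_theorem\<close> applies.\<close>
  define b where "b = nat (a mod int q)"
  have "q > 0" using assms(1) by (simp add: prime_gt_0_nat)
  then have b: "int b = a mod int q" by (simp add: b_def)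
  then have "\<not> q dvd b" using assms(2) by (metis dvd_mod_iff dvd_refl int_dvd_int_iff)
  then have "[b ^ (q - 1) = 1] (mod q)" using assms(1) by (rule fermat_theorem[rotated])
  then have "[int b ^ (q - 1) = 1] (mod int q)" by (metis cong_int_iff of_nat_1 of_nat_power)
  then have "[a ^ (q - 1) = 1] (mod int q)" by (simp add: b cong_def power_mod)
  then show ?thesis by (metis cong_iff_dvd_diff cong_sym)
qed

lemma not_dvd_two_times:
  assumes "prime q" "odd q" "\<not> q dvd d"
  shows "\<not> int q dvd 2 * int d"
proof
  assume "int q dvd 2 * int d"
  then have "q dvd 2 * d" by (metis int_dvd_int_iff of_nat_mult of_nat_numeral)
  then show False
    using assms by (metis dvd_refl prime_dvd_mult_iff primes_dvd_imp_eq two_is_prime_nat)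
qed

text \<open>At \<open>s = n - 2 d\<close> the polynomial \<open>1 - (n - s)^(q - 1)\<close> becomes
  \<open>1 - (2 d)^(q - 1)\<close>, which Fermat makes divisible by \<open>q\<close>; at
  \<open>s = n\<close> its value is 1.\<close>

lemma card_avoiding_le:
  assumes q: "prime q" "odd q" and F: "F \<subseteq> Pow {..<n}" "avoiding q F"
  shows "card F \<le> (\<Sum>k\<le>q - 1. n choose k)"
proof -
  let ?G = "subsets_of_size_in n {..q - 1}"
  have "q > 1" using q prime_gt_1_nat by blast
  have "card F \<le> card ?G"
  proof (rule card_le_of_multilinear[OF q(1) F(1), where p = "\<lambda>s. 1 - (int n - s) ^ (q - 1)"])
    have "multilinear_on n ?G (\<lambda>w. 1 + (-1) * (int n - (\<Sum>i<n. w i)) ^ (q - 1))"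
      by (intro multilinear_on_add multilinear_on_scale multilinear_on_affine_power
          multilinear_on_one) simp
    then show "multilinear_on n ?G (\<lambda>w. 1 - (int n - (\<Sum>i<n. w i)) ^ (q - 1))"
      by simp
    show "\<not> int q dvd 1 - (int n - int n) ^ (q - 1)"
      using \<open>q > 1\<close> by (simp add: zero_power)
    show "int q dvd 1 - (int n - (int n - 2 * int (card (sym_diff K L)))) ^ (q - 1)"
      if "K \<in> F" "L \<in> F" "K \<noteq> L" for K L
    proof -
      have "\<not> q dvd card (sym_diff K L)" using F(2) that unfolding avoiding_def by blast
      from fermat_dvd_one_minus_power[OF q(1) not_dvd_two_times[OF q this]]
      show ?thesis by simp
    qed
  qed auto
  also have "card ?G = (\<Sum>k\<le>q - 1. n choose k)"
    by (rule card_subsets_of_size_in) simp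
  finally show ?thesis .
qed

lemma card_avoiding_le_if_dvd:
  assumes q: "prime q" "odd q" and F: "F \<subseteq> Pow {..<n}" "avoiding q F" and n: "q dvd n"
  shows "card F \<le> (\<Sum>k | k \<le> q - 1 \<and> even k. n choose k)"
proof -
  let ?G = "subsets_of_size_in n {k. k \<le> q - 1 \<and> even k}"
  have "q > 1" using q prime_gt_1_nat by blast
  \<comment> \<open>As \<open>q\<close> is odd, \<open>q - 1\<close> is even, so the surviving
    degrees are the even ones.\<close>
  have eq: "{k. k \<le> q - 1 \<and> even (k + (q - 1))} = {k. k \<le> q - 1 \<and> even k}"
    using q(2) by auto
  have "card F \<le> card ?G"
  proof (rule card_le_of_multilinear[OF q(1) F(1), where p = "\<lambda>s. 1 - s ^ (q - 1)"])
    have "multilinear_on n ?G (\<lambda>w. 1 + (-1) * (\<Sum>i<n. w i) ^ (q - 1))"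
      using multilinear_on_sum_power[of n "q - 1"] unfolding eq
      by (intro multilinear_on_add multilinear_on_scale multilinear_on_one) simp_all
    then show "multilinear_on n ?G (\<lambda>w. 1 - (\<Sum>i<n. w i) ^ (q - 1))"
      by simp
    have "int q dvd int n ^ (q - 1)"
      using n \<open>q > 1\<close> by (intro dvd_trans[OF _ dvd_power]) auto
    then show "\<not> int q dvd 1 - int n ^ (q - 1)"
      using \<open>q > 1\<close> by (simp add: dvd_diff_left_iff)
    show "int q dvd 1 - (int n - 2 * int (card (sym_diff K L))) ^ (q - 1)"
      if "K \<in> F" "L \<in> F" "K \<noteq> L" for K L
    proof (rule fermat_dvd_one_minus_power[OF q(1)])
      have "\<not> q dvd card (sym_diff K L)" using F(2) that unfolding avoiding_def by blast
      from not_dvd_two_times[OF q this]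
      show "\<not> int q dvd int n - 2 * int (card (sym_diff K L))"
        using n by (metis dvd_diff_right_iff int_dvd_int_iff)
    qed
  qed auto
  also have "card ?G = (\<Sum>k | k \<le> q - 1 \<and> even k. n choose k)"
    by (rule card_subsets_of_size_in) simp
  finally show ?thesis .
qed

section \<open>Constructions for the lower bounds\<close>

lemma card_sym_diff:
  assumes "finite K" "finite L"
  shows "card (sym_diff K L) + 2 * card (K \<inter> L) = card K + card L"
proof -
  have "card (sym_diff K L) = card (K - L) + card (L - K)"
    using assms by (intro card_Un_disjoint) auto
  moreover have "card K = card (K - L) + card (K \<inter> L)"
    using assms by (metis add.commute card_Int_Diff)
  moreover have "card L = card (L - K) + card (K \<inter> L)"
    using assms by (metis Int_commute add.commute card_Int_Diff)
  ultimately show ?thesis by simp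
qed

text \<open>The only multiple of \<open>q\<close> strictly between 0 and \<open>2 q\<close> is
  \<open>q\<close> itself, which is odd.\<close>

lemma not_dvd_even_of_less:
  fixes q d :: nat
  assumes "odd q" "even d" "0 < d" "d < 2 * q"
  shows "\<not> q dvd d"
proof
  assume "q dvd d"
  then obtain m where m: "d = q * m" by blast
  then have "m < 2" "m > 0" using assms by (auto simp: mult.commute)
  then have "m = 1" by simp
  then show False using m assms by simp
qed

lemma not_dvd_card_sym_diff_same_parity:
  fixes n :: nat
  assumes "odd q" "K \<subseteq> {..<n}" "L \<subseteq> {..<n}" "K \<noteq> L"
    and "even (card K + card L)" "card K < q" "card L < q"
  shows "\<not> q dvd card (sym_diff K L)"
proof (rule not_dvd_even_of_less[OF assms(1)])
  have fin: "finite K" "finite L"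
    using assms(2,3) by (auto intro: finite_subset)
  note d = card_sym_diff[OF fin]
  show "even (card (sym_diff K L))" using d assms(5) by presburger
  show "card (sym_diff K L) < 2 * q" using d assms by linarith
  show "0 < card (sym_diff K L)" using fin assms(4) by (auto simp: card_gt_0_iff)
qed

lemma avoiding_even:
  assumes "odd q"
  shows "avoiding q (subsets_of_size_in n {k. k \<le> q - 1 \<and> even k})"
  unfolding avoiding_def
proof (intro ballI impI)
  have "q > 0" using assms by (rule odd_pos)
  fix K L
  assume "K \<in> subsets_of_size_in n {k. k \<le> q - 1 \<and> even k}"
    "L \<in> subsets_of_size_in n {k. k \<le> q - 1 \<and> even k}" "K \<noteq> L"
  then show "\<not> q dvd card (sym_diff K L)"
    using \<open>q > 0\<close> by (intro not_dvd_card_sym_diff_same_parity[OF assms]) auto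
qed

lemma exists_avoiding_if_minus_one:
  assumes q: "odd q" and n: "q dvd n + 1"
  shows "\<exists>F \<subseteq> Pow {..<n}. avoiding q F \<and> card F = (\<Sum>k\<le>q - 1. n choose k)"
proof -
  let ?E = "subsets_of_size_in n {k. k \<le> q - 1 \<and> even k}"
  let ?O = "subsets_of_size_in n {k. k \<le> q - 1 \<and> odd k}"
  let ?c = "\<lambda>L. {..<n} - L"
  have q0: "q > 0" using q by (rule odd_pos)
  have mixed: "\<not> q dvd card (sym_diff K (?c L))" if "K \<in> ?E" "L \<in> ?O" for K L
  proof
    assume dvd: "q dvd card (sym_diff K (?c L))"
    let ?d = "card (sym_diff K L)"
    have fin: "finite K" "finite L" and sub: "K \<subseteq> {..<n}" "L \<subseteq> {..<n}"
      using that by (auto intro: finite_subset)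
    note d = card_sym_diff[OF fin]
    have "sym_diff K (?c L) = {..<n} - sym_diff K L" using sub by blast
    moreover have sub': "sym_diff K L \<subseteq> {..<n}" using sub by blast
    ultimately have "card (sym_diff K (?c L)) = n - ?d"
      using fin by (simp add: card_Diff_subset)
    moreover have "?d \<le> n" using card_mono[OF _ sub'] by simp
    \<comment> \<open>The split of \<open>n + 1\<close> turns divisibility of the mixed distance
      into divisibility of \<open>?d + 1\<close>; it relies on \<open>?d\<close> not exceeding
      \<open>n\<close>, the subtraction being truncated.\<close>
    ultimately have "q dvd n - ?d" "n + 1 = (n - ?d) + (?d + 1)"
      using dvd by auto
    then have "q dvd ?d + 1" using n by (metis dvd_add_right_iff)
    \<comment> \<open>Sizes of opposite parity make \<open>?d\<close> odd, and \<open>?d\<close> is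
      at most \<open>2 (q - 1)\<close>, so \<open>?d + 1\<close> is even, positive and below
      \<open>2 q\<close>.\<close>
    moreover have "\<not> q dvd ?d + 1"
    proof (rule not_dvd_even_of_less[OF q])
      have par: "even (card K)" "odd (card L)" "card K \<le> q - 1" "card L \<le> q - 1"
        using that by auto
      show "even (?d + 1)" using d par by presburger
      show "?d + 1 < 2 * q" using d par q0 by linarith
    qed simp
    ultimately show False by blast
  qed
  \<comment> \<open>Complementing both sets preserves their distance, so two added sets fall under
    the same-parity case.\<close>
  have compl: "sym_diff (?c K) (?c L) = sym_diff K L" if "K \<in> ?O" "L \<in> ?O" for K L
    using that by blast
  let ?F = "?E \<union> ?c ` ?O"
  have "avoiding q ?F"
    unfolding avoiding_def
  proof (intro ballI impI)
    fix K L
    assume KL: "K \<in> ?F" "L \<in> ?F" "K \<noteq> L"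
    have comm: "sym_diff A B = sym_diff B A" for A B :: "nat set" by blast
    consider "K \<in> ?E" "L \<in> ?E" | "K \<in> ?E" "L \<in> ?c ` ?O" | "K \<in> ?c ` ?O" "L \<in> ?E"
      | "K \<in> ?c ` ?O" "L \<in> ?c ` ?O"
      using KL by blast
    then show "\<not> q dvd card (sym_diff K L)"
    proof cases
      case 1
      then show ?thesis using avoiding_even[OF q] KL(3) unfolding avoiding_def by blast
    next
      case 2
      then show ?thesis using mixed by blast
    next
      case 3
      then obtain A where A: "A \<in> ?O" "K = ?c A" by blast
      then show ?thesis using mixed[OF 3(2) A(1)] comm[of L K] by simp
    next
      case 4
      then obtain A B where AB: "A \<in> ?O" "B \<in> ?O" "K = ?c A" "L = ?c B" by blast
      then have "\<not> q dvd card (sym_diff A B)"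
        using KL(3) q0 by (intro not_dvd_card_sym_diff_same_parity[OF q]) auto
      then show ?thesis using compl[OF AB(1,2)] AB by simp
    qed
  qed
  moreover have "card ?F = (\<Sum>k\<le>q - 1. n choose k)"
  proof -
    \<comment> \<open>A common member would have mixed distance 0 from itself, and \<open>q\<close>
      divides 0.\<close>
    have "?E \<inter> ?c ` ?O = {}"
    proof (rule ccontr)
      assume "?E \<inter> ?c ` ?O \<noteq> {}"
      then obtain L where "L \<in> ?O" "?c L \<in> ?E" by blast
      then have "\<not> q dvd card (sym_diff (?c L) (?c L))" by (intro mixed)
      then show False by simp
    qed
    then have "card ?F = card ?E + card (?c ` ?O)"
      by (intro card_Un_disjoint) auto
    also have "card (?c ` ?O) = card ?O"
      by (intro card_image inj_onI) blast
    also have "card ?E + card ?O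
      = (\<Sum>k | k \<le> q - 1 \<and> even k. n choose k) + (\<Sum>k | k \<le> q - 1 \<and> odd k. n choose k)"
      by (subst (1 2) card_subsets_of_size_in) simp_all
    also have "\<dots> = (\<Sum>k \<in> {k. k \<le> q - 1 \<and> even k} \<union> {k. k \<le> q - 1 \<and> odd k}. n choose k)"
      by (rule sum.union_disjoint[symmetric]) auto
    also have "{k. k \<le> q - 1 \<and> even k} \<union> {k. k \<le> q - 1 \<and> odd k} = {..q - 1}"
      by auto
    finally show ?thesis .
  qed
  moreover have "?F \<subseteq> Pow {..<n}" by auto
  ultimately show ?thesis by blast
qed

section \<open>Words as sets\<close>

definition word_of_set :: "'a \<Rightarrow> 'a \<Rightarrow> nat \<Rightarrow> nat set \<Rightarrow> 'a list" where
  "word_of_set a b n K = map (\<lambda>i. if i \<in> K then b else a) [0..<n]"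

lemma bij_betw_word_of_set:
  assumes "a \<noteq> b"
  shows "bij_betw (word_of_set a b n) (Pow {..<n}) (words {a, b} n)"
proof (rule bij_betw_byWitness[where f' = "\<lambda>x. {i. i < n \<and> x ! i = b}"])
  show "\<forall>K\<in>Pow {..<n}. {i. i < n \<and> word_of_set a b n K ! i = b} = K"
    using assms by (auto simp: word_of_set_def split: if_splits)
  show "\<forall>x\<in>words {a, b} n. word_of_set a b n {i. i < n \<and> x ! i = b} = x"
  proof
    fix x
    assume x: "x \<in> words {a, b} n"
    then have "x ! i \<in> {a, b}" if "i < n" for i
      using that nth_mem unfolding words_def by blast
    then show "word_of_set a b n {i. i < n \<and> x ! i = b} = x"
      using x by (intro nth_equalityI) (auto simp: word_of_set_def words_def)
  qed
qed (auto simp: word_of_set_def words_def)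

lemma hamming_dist_word_of_set:
  assumes "a \<noteq> b" "K \<subseteq> {..<n}" "L \<subseteq> {..<n}"
  shows "hamming_dist (word_of_set a b n K) (word_of_set a b n L) = card (sym_diff K L)"
proof -
  have "{i. i < n \<and> word_of_set a b n K ! i \<noteq> word_of_set a b n L ! i} = sym_diff K L"
    using assms by (auto simp: word_of_set_def split: if_splits)
  then show ?thesis
    by (simp add: hamming_dist_def word_of_set_def)
qed

lemma no_dist_divisible_word_of_set:
  assumes "a \<noteq> b" "F \<subseteq> Pow {..<n}"
  shows "no_dist_divisible q (word_of_set a b n ` F) \<longleftrightarrow> avoiding q F"
proof -
  have "inj_on (word_of_set a b n) F"
    using bij_betw_word_of_set[OF assms(1)] assms(2) bij_betw_imp_inj_on inj_on_subset by blast
  moreover have "hamming_dist (word_of_set a b n K) (word_of_set a b n L) = card (sym_diff K L)"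
    if "K \<in> F" "L \<in> F" for K L
    using that assms by (intro hamming_dist_word_of_set) auto
  ultimately show ?thesis
    unfolding no_dist_divisible_def avoiding_def by (simp add: inj_on_eq_iff)
qed

lemma T_eq_Max_avoiding:
  assumes "a \<noteq> b"
  shows "T a b n q = Max (card ` {F. F \<subseteq> Pow {..<n} \<and> avoiding q F})"
proof -
  let ?w = "word_of_set a b n"
  have inj: "inj_on ?w (Pow {..<n})" and im: "?w ` Pow {..<n} = words {a, b} n"
    using bij_betw_word_of_set[OF assms] by (auto simp: bij_betw_def)
  have "{card S | S. S \<subseteq> words {a, b} n \<and> no_dist_divisible q S}
      = {card (?w ` F) | F. F \<subseteq> Pow {..<n} \<and> no_dist_divisible q (?w ` F)}"
    unfolding im[symmetric] subset_image_iff by blast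
  also have "\<dots> = {card F | F. F \<subseteq> Pow {..<n} \<and> avoiding q F}"
    using no_dist_divisible_word_of_set[OF assms] card_image[OF inj_on_subset[OF inj]]
    by (metis (no_types, lifting))
  finally show ?thesis
    unfolding T_def by (simp add: setcompr_eq_image)
qed

lemma T_le_iff:
  assumes "a \<noteq> b"
  shows "T a b n q \<le> m \<longleftrightarrow> (\<forall>F \<subseteq> Pow {..<n}. avoiding q F \<longrightarrow> card F \<le> m)"
proof -
  \<comment> \<open>The empty family makes the set under \<open>Max\<close> nonempty, as
    \<open>Max_le_iff\<close> demands.\<close>
  have "avoiding q {}" by (simp add: avoiding_def)
  then show ?thesis
    unfolding T_eq_Max_avoiding[OF assms] by (subst Max_le_iff) auto
qed

lemma T_ge:
  assumes "a \<noteq> b" "F \<subseteq> Pow {..<n}" "avoiding q F"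
  shows "card F \<le> T a b n q"
  \<comment> \<open>Here the bound \<open>m\<close> is \<open>T a b n q\<close> itself.\<close>
  using T_le_iff[OF assms(1)] assms(2,3) by blast

theorem theorem1p8:
  fixes a b :: 'a and n q :: nat
  assumes "prime q" and "odd q" and "n > 0" and "a \<noteq> b"
  shows "T a b n q \<le> (\<Sum>k\<le>q - 1. n choose k)
    \<and> ([n = 0] (mod q) \<longrightarrow> T a b n q \<le> (\<Sum>k | k \<le> q - 1 \<and> even k. n choose k))
    \<and> T a b n q \<ge> (\<Sum>k | k \<le> q - 1 \<and> even k. n choose k)
    \<and> ([int n = -1] (mod int q) \<longrightarrow> T a b n q \<ge> (\<Sum>k\<le>q - 1. n choose k))"
proof (intro conjI impI)
  show "T a b n q \<le> (\<Sum>k\<le>q - 1. n choose k)"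
    using card_avoiding_le assms by (auto simp: T_le_iff)
  show "T a b n q \<le> (\<Sum>k | k \<le> q - 1 \<and> even k. n choose k)" if "[n = 0] (mod q)"
    using card_avoiding_le_if_dvd that assms by (auto simp: T_le_iff cong_0_iff)
  show "T a b n q \<ge> (\<Sum>k | k \<le> q - 1 \<and> even k. n choose k)"
  proof -
    let ?E = "subsets_of_size_in n {k. k \<le> q - 1 \<and> even k}"
    have "card ?E = (\<Sum>k | k \<le> q - 1 \<and> even k. n choose k)"
      by (rule card_subsets_of_size_in) simp
    moreover have "card ?E \<le> T a b n q"
      by (rule T_ge[OF assms(4) _ avoiding_even[OF assms(2)]]) auto
    ultimately show ?thesis by simp
  qed
  show "T a b n q \<ge> (\<Sum>k\<le>q - 1. n choose k)" if "[int n = -1] (mod int q)"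
  proof -
    have "int q dvd int (n + 1)"
      using that by (simp add: cong_iff_dvd_diff add.commute)
    then have "q dvd n + 1" by (simp only: int_dvd_int_iff)
    then obtain F where "F \<subseteq> Pow {..<n}" "avoiding q F" "card F = (\<Sum>k\<le>q - 1. n choose k)"
      using exists_avoiding_if_minus_one[OF assms(2)] by blast
    then show ?thesis using T_ge[OF assms(4)] by metis
  qed
qed

end
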